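(* Let $G$ be an infinite group, let $A, B \subset G$ be subsets with $A \cap B = \varnothing$, let $W = W_G(A,B)$, and let $\lambda := \max\{|A|, |B|, \aleph_0\}$. If $|W| > \lambda$, then $A$ and $B$ are separable in $G$; moreover, there exists a countable witness set $X$ for $A$ and $B$.
   Context: All arguments are in ZFC. Let $G$ be an infinite group with identity $e$, and let $A, B \subset G$ be disjoint subsets. We say $A$ and $B$ are separable in $G$ if there exists a subset $X \subset G$ such that (1) $X$ is infinite; (2) $e \in X$; (3) $X = X^{-1}$, i.e. $x \in X \Rightarrow x^{-1} \in X$; (4) $XAX \cap B = \varnothing$, where $XAX = \{x a x' : x, x' \in X,\ a \in A\}$. Such a set $X$ is called a witness set for $A$ and $B$. Define $W_G(A,B) := \{u \in G : \{u,u^{-1}\}\, A\, \{u,u^{-1}\} \cap B = \varnothing\}$, i.e. $u \in W_G(A,B)$ if and only if the four sets $uAu$, $uAu^{-1}$, $u^{-1}Au$, $u^{-1}Au^{-1}$ are all disjoint from $B$. *)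

theory Defs
  imports "HOL-Algebra.Coset" "HOL-Library.Countable_Set"
begin

unbundle cardinal_syntax

definition witness_set :: "('a, 'm) monoid_scheme \<Rightarrow> 'a set \<Rightarrow> 'a set \<Rightarrow> 'a set \<Rightarrow> bool" where
  "witness_set G A B X \<longleftrightarrow>
     X \<subseteq> carrier G \<and> infinite X \<and> \<one>\<^bsub>G\<^esub> \<in> X \<and> set_inv\<^bsub>G\<^esub> X = X \<and>
     (X <#>\<^bsub>G\<^esub> A <#>\<^bsub>G\<^esub> X) \<inter> B = {}"

definition separable :: "('a, 'm) monoid_scheme \<Rightarrow> 'a set \<Rightarrow> 'a set \<Rightarrow> bool" where
  "separable G A B \<longleftrightarrow> (\<exists>X. witness_set G A B X)"

definition W_set :: "('a, 'm) monoid_scheme \<Rightarrow> 'a set \<Rightarrow> 'a set \<Rightarrow> 'a set" where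
  "W_set G A B =
     {u \<in> carrier G. ({u, inv\<^bsub>G\<^esub> u} <#>\<^bsub>G\<^esub> A <#>\<^bsub>G\<^esub> {u, inv\<^bsub>G\<^esub> u}) \<inter> B = {}}"

text \<open>
  Maximum of two cardinals. They may live on different types, so the larger one is
  copied into the sum type; copying does not change the cardinal.
\<close>

definition card_max :: "'a rel \<Rightarrow> 'b rel \<Rightarrow> ('a + 'b) rel" where
  "card_max r s = (if r \<le>o s then |Inr ` Field s| else |Inl ` Field r| )"

lemma card_max_eq:
  fixes r :: "'a rel" and s :: "'b rel"
  assumes "Card_order r" "Card_order s"
  shows "r \<le>o s \<Longrightarrow> card_max r s =o s" and "s \<le>o r \<Longrightarrow> card_max r s =o r"
proof -
  have "|(Inr :: 'b \<Rightarrow> 'a + 'b) ` Field s| =o |Field s|"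
    by (rule ordIso_symmetric, rule card_of_ordIsoI[where f = Inr])
       (simp add: bij_betw_def)
  then have s: "|(Inr :: 'b \<Rightarrow> 'a + 'b) ` Field s| =o s"
    using card_of_Field_ordIso[OF assms(2)] by (rule ordIso_transitive)
  have "|(Inl :: 'a \<Rightarrow> 'a + 'b) ` Field r| =o |Field r|"
    by (rule ordIso_symmetric, rule card_of_ordIsoI[where f = Inl])
       (simp add: bij_betw_def)
  then have r: "|(Inl :: 'a \<Rightarrow> 'a + 'b) ` Field r| =o r"
    using card_of_Field_ordIso[OF assms(1)] by (rule ordIso_transitive)
  show "r \<le>o s \<Longrightarrow> card_max r s =o s"
    using s by (simp add: card_max_def)
  show "s \<le>o r \<Longrightarrow> card_max r s =o r"
  proof (cases "r \<le>o s")
    case True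
    assume "s \<le>o r"
    with True have "s =o r" by (simp add: ordIso_iff_ordLeq)
    with s have "|(Inr :: 'b \<Rightarrow> 'a + 'b) ` Field s| =o r"
      by (rule ordIso_transitive)
    then show ?thesis using True by (simp add: card_max_def)
  next
    case False
    then show ?thesis using r by (simp add: card_max_def)
  qed
qed

end

theory Submission
  imports Defs
begin

text \<open>
  Call \<open>x\<close> and \<open>y\<close> \<^emph>\<open>clashing\<close> if \<open>{x, x\<inverse>} A {y, y\<inverse>}\<close> meets \<open>B\<close>; thus \<open>W\<close> consists of the
  elements that do not clash with themselves, and it contains the identity because \<open>A\<close> and \<open>B\<close>
  are disjoint. A set of the form \<open>X = {s\<^sub>n, s\<^sub>n\<inverse> | n}\<close> satisfies \<open>X A X \<inter> B = {}\<close> as soon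
  as no two \<open>s\<^sub>i, s\<^sub>j\<close> clash, in either order and including the case \<open>i = j\<close>.

  Let \<open>\<lambda>\<close> be the maximum of \<open>|A|\<close>, \<open>|B|\<close> and the cardinal of the naturals.
  For a fixed \<open>x\<close>, an element that clashes with \<open>x\<close> is, up to inversion, the solution \<open>v\<close> of an
  equation \<open>v a y = b\<close> or \<open>y a v = b\<close> with \<open>a \<in> A\<close>, \<open>b \<in> B\<close> and \<open>y \<in> {x, x\<inverse>}\<close>. Cancellation
  makes \<open>v\<close> a function of \<open>(a, b, y)\<close>, so there are at most \<open>\<lambda>\<close> such elements
  (\<open>card_clashing\<close>). Finitely many choices therefore exclude at most \<open>\<lambda>\<close> elements of \<open>W\<close>,
  and since \<open>|W| > \<lambda>\<close> a sequence of pairwise distinct and pairwise non-clashing elements of \<open>W\<close>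
  can be chosen step by step, starting from the identity (\<open>exists_sequence_avoiding\<close>).
\<close>

lemma Card_order_card_max: "Card_order (card_max r s)"
  by (simp add: card_max_def card_of_Card_order)

lemma
  assumes "Card_order r" "Card_order s"
  shows ordLeq_card_max1: "r \<le>o card_max r s"
    and ordLeq_card_max2: "s \<le>o card_max r s"
proof -
  have wo: "Well_order r" "Well_order s"
    using assms by (auto simp: card_order_on_def)
  consider "r \<le>o s" | "s \<le>o r"
    using ordLeq_total[OF wo] by blast
  then have "r \<le>o card_max r s \<and> s \<le>o card_max r s"
  proof cases
    case 1
    then have "s \<le>o card_max r s"
      using card_max_eq(1)[OF assms] by (simp add: ordIso_iff_ordLeq)
    with 1 show ?thesis by (blast intro: ordLeq_transitive)
  next
    case 2
    then have "r \<le>o card_max r s"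
      using card_max_eq(2)[OF assms] by (simp add: ordIso_iff_ordLeq)
    with 2 show ?thesis by (blast intro: ordLeq_transitive)
  qed
  then show "r \<le>o card_max r s" "s \<le>o card_max r s" by auto
qed

lemma infinite_Field_if_natLeq_ordLeq:
  assumes "Card_order k" "natLeq \<le>o k"
  shows "infinite (Field k)"
proof -
  have "natLeq \<le>o |Field k|"
    using assms card_of_Field_ordIso ordIso_symmetric ordLeq_ordIso_trans by blast
  then show ?thesis using infinite_iff_natLeq_ordLeq by blast
qed

lemma finite_ordLeq_infinite_Card_order:
  assumes "finite X" "Card_order k" "infinite (Field k)"
  shows "|X| \<le>o k"
  using assms card_of_Well_order
  by (intro ordLess_imp_ordLeq finite_ordLess_infinite)
     (auto simp: card_order_on_def Field_card_of)

text \<open>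
  The greedy choice: before each step the finitely many forbidden sets have a union of size at
  most \<open>k\<close>, which cannot exhaust \<open>W\<close>.
\<close>

lemma exists_sequence_avoiding:
  fixes W :: "'a set" and bad :: "'a \<Rightarrow> 'a set"
  assumes k: "Card_order k" "infinite (Field k)"
    and W: "k <o |W|" "w \<in> W"
    and bad: "\<And>x. x \<in> W \<Longrightarrow> |bad x| \<le>o k"
  shows "\<exists>s :: nat \<Rightarrow> 'a. s 0 = w \<and> (\<forall>n. s n \<in> W) \<and> (\<forall>n. \<forall>i<n. s n \<notin> bad (s i))"
proof -
  define P where "P s n r \<longleftrightarrow> r \<in> W \<and> (n = 0 \<longrightarrow> r = w) \<and> (\<forall>i<n. r \<notin> bad (s i))"
    for s and n :: nat and r
  have "\<exists>s. \<forall>n. P s n (s n)"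
  proof (rule dependent_wellorder_choice)
    show "P f n r = P g n r" if "\<And>i. i < n \<Longrightarrow> f i = g i" for r f g n
      using that by (simp add: P_def)
    show "\<exists>r. P s n r" if *: "\<And>i. i < n \<Longrightarrow> P s i (s i)" for n s
    proof (cases "n = 0")
      case True
      then show ?thesis using W by (auto simp: P_def)
    next
      case False
      have "|{..<n}| \<le>o k"
        using k by (intro finite_ordLeq_infinite_Card_order) auto
      then have "|\<Union>i<n. bad (s i)| \<le>o k"
        using * bad k by (intro card_of_UNION_ordLeq_infinite_Field) (auto simp: P_def)
      then have "|\<Union>i<n. bad (s i)| <o |W|"
        using W(1) ordLeq_ordLess_trans by blast
      then have "\<not> W \<subseteq> (\<Union>i<n. bad (s i))"
        using card_of_mono1 not_ordLess_ordLeq by blast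
      then show ?thesis using False by (auto simp: P_def)
    qed
  qed
  then obtain s where "\<And>n. P s n (s n)" by blast
  then show ?thesis by (intro exI[of _ s]) (simp add: P_def)
qed

definition clash :: "('a, 'm) monoid_scheme \<Rightarrow> 'a set \<Rightarrow> 'a set \<Rightarrow> 'a \<Rightarrow> 'a \<Rightarrow> bool" where
  "clash G A B x y \<longleftrightarrow>
     ({x, inv\<^bsub>G\<^esub> x} <#>\<^bsub>G\<^esub> A <#>\<^bsub>G\<^esub> {y, inv\<^bsub>G\<^esub> y}) \<inter> B \<noteq> {}"

lemma clash_iff:
  "clash G A B x y \<longleftrightarrow>
     (\<exists>x'\<in>{x, inv\<^bsub>G\<^esub> x}. \<exists>a\<in>A. \<exists>y'\<in>{y, inv\<^bsub>G\<^esub> y}. x' \<otimes>\<^bsub>G\<^esub> a \<otimes>\<^bsub>G\<^esub> y' \<in> B)"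
  unfolding clash_def set_mult_def by blast

lemma W_set_iff: "u \<in> W_set G A B \<longleftrightarrow> u \<in> carrier G \<and> \<not> clash G A B u u"
  by (simp add: W_set_def clash_def)

context group
begin

lemma one_in_W_set:
  assumes "A \<subseteq> carrier G" "A \<inter> B = {}"
  shows "\<one> \<in> W_set G A B"
  using assms by (force simp: W_set_iff clash_iff)

text \<open>
  The equations \<open>v a y = b\<close> and \<open>y a v = b\<close> have the unique solutions \<open>v = b y\<inverse> a\<inverse>\<close> and
  \<open>v = a\<inverse> y\<inverse> b\<close>, so their solution set is covered by two images of \<open>A \<times> B\<close>.
\<close>

lemma card_solutions:
  assumes k: "Card_order k" "infinite (Field k)"
    and AB: "A \<subseteq> carrier G" "|A| \<le>o k" "|B| \<le>o k"
    and y: "y \<in> carrier G"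
  shows "|{v \<in> carrier G. \<exists>a\<in>A. v \<otimes> a \<otimes> y \<in> B \<or> y \<otimes> a \<otimes> v \<in> B}| \<le>o k" (is "|?S| \<le>o k")
proof -
  define f where "f = (\<lambda>(a, b). b \<otimes> inv y \<otimes> inv a)"
  define g where "g = (\<lambda>(a, b). inv a \<otimes> (inv y \<otimes> b))"
  have "?S \<subseteq> f ` (A \<times> B) \<union> g ` (A \<times> B)"
  proof
    fix v assume "v \<in> ?S"
    then obtain a where v: "v \<in> carrier G" and a: "a \<in> A"
      and "v \<otimes> a \<otimes> y \<in> B \<or> y \<otimes> a \<otimes> v \<in> B"
      by blast
    moreover have ac: "a \<in> carrier G" using a AB by blast
    have "v = f (a, v \<otimes> a \<otimes> y)" "v = g (a, y \<otimes> a \<otimes> v)"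
      using v ac y by (simp_all add: f_def g_def m_assoc inv_solve_left inv_solve_left' inv_solve_right)
    ultimately show "v \<in> f ` (A \<times> B) \<union> g ` (A \<times> B)"
      by blast
  qed
  moreover have "|A \<times> B| \<le>o k"
    using AB k by (intro card_of_Times_ordLeq_infinite_Field)
  then have "|f ` (A \<times> B) \<union> g ` (A \<times> B)| \<le>o k"
    using k card_of_image ordLeq_transitive
    by (intro card_of_Un_ordLeq_infinite_Field) blast+
  ultimately show ?thesis
    using card_of_mono1 ordLeq_transitive by blast
qed

lemma card_clashing:
  assumes k: "Card_order k" "infinite (Field k)"
    and AB: "A \<subseteq> carrier G" "|A| \<le>o k" "|B| \<le>o k"
    and x: "x \<in> carrier G"
  shows "|{u \<in> carrier G. clash G A B u x \<or> clash G A B x u}| \<le>o k" (is "|?C| \<le>o k")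
proof -
  define S where "S y = {v \<in> carrier G. \<exists>a\<in>A. v \<otimes> a \<otimes> y \<in> B \<or> y \<otimes> a \<otimes> v \<in> B}" for y
  define T where "T = S x \<union> S (inv x)"
  have "?C \<subseteq> T \<union> m_inv G ` T"
  proof
    fix u assume u: "u \<in> ?C"
    then have "u \<in> T \<or> inv u \<in> T"
      by (auto simp: clash_iff T_def S_def)
    moreover have "u = inv (inv u)" using u by simp
    ultimately show "u \<in> T \<union> m_inv G ` T" by blast
  qed
  moreover have "|T| \<le>o k"
    unfolding T_def S_def using assms
    by (intro card_of_Un_ordLeq_infinite_Field card_solutions) auto
  then have "|T \<union> m_inv G ` T| \<le>o k"
    using k card_of_image ordLeq_transitive
    by (intro card_of_Un_ordLeq_infinite_Field) blast+
  ultimately show ?thesis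
    using card_of_mono1 ordLeq_transitive by blast
qed

lemma witness_set_if_no_clash:
  fixes s :: "nat \<Rightarrow> 'a"
  assumes "s 0 = \<one>" "\<And>n. s n \<in> carrier G" "inj s" "\<And>i j. \<not> clash G A B (s i) (s j)"
  shows "witness_set G A B (\<Union>n. {s n, inv (s n)})" (is "witness_set G A B ?X")
  unfolding witness_set_def
proof (intro conjI)
  show "?X \<subseteq> carrier G" using assms(2) by auto
  have "range s \<subseteq> ?X" by auto
  then show "infinite ?X"
    using range_inj_infinite[OF assms(3)] finite_subset by blast
  show "\<one> \<in> ?X" using assms(1) by (auto intro!: exI[of _ 0])
  show "set_inv ?X = ?X" using assms(2) by (auto simp: SET_INV_def)
  show "(?X <#> A <#> ?X) \<inter> B = {}"
    using assms(4) unfolding clash_iff set_mult_def by blast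
qed

end

theorem lemma3p2:
  fixes G :: "('a, 'm) monoid_scheme" and A B :: "'a set"
  assumes "group G" and "infinite (carrier G)"
    and "A \<subseteq> carrier G" and "B \<subseteq> carrier G" and "A \<inter> B = {}"
    and "card_max (card_max |A| |B| ) natLeq <o |W_set G A B|"
  shows "separable G A B \<and> (\<exists>X. countable X \<and> witness_set G A B X)"
proof -
  interpret group G by fact
  define k where "k = card_max (card_max |A| |B| ) natLeq"
  have k: "Card_order k" by (simp add: k_def Card_order_card_max)
  have "card_max |A| |B| \<le>o k"
    unfolding k_def by (intro ordLeq_card_max1 Card_order_card_max natLeq_Card_order)
  then have AB: "|A| \<le>o k" "|B| \<le>o k"
    using ordLeq_card_max1 ordLeq_card_max2 card_of_Card_order ordLeq_transitive by blast+
  have inf: "infinite (Field k)"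
    using k unfolding k_def
    by (intro infinite_Field_if_natLeq_ordLeq ordLeq_card_max2 Card_order_card_max
        natLeq_Card_order)
  \<comment> \<open>Forbidding \<open>x\<close> itself as well makes the chosen sequence injective.\<close>
  define bad where "bad x = {x} \<union> {u \<in> carrier G. clash G A B u x \<or> clash G A B x u}" for x
  have "|bad x| \<le>o k" if "x \<in> W_set G A B" for x
  proof -
    have "|{x}| \<le>o k"
      using k inf by (intro finite_ordLeq_infinite_Card_order) auto
    then show ?thesis
      unfolding bad_def using that k inf AB assms(3)
      by (intro card_of_Un_ordLeq_infinite_Field card_clashing) (auto simp: W_set_iff)
  qed
  then have "\<exists>s :: nat \<Rightarrow> 'a. s 0 = \<one>\<^bsub>G\<^esub> \<and> (\<forall>n. s n \<in> W_set G A B) \<and>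
      (\<forall>n. \<forall>i<n. s n \<notin> bad (s i))"
    by (rule exists_sequence_avoiding[OF k inf assms(6)[folded k_def]
        one_in_W_set[OF assms(3,5)]])
  then obtain s :: "nat \<Rightarrow> 'a" where s: "s 0 = \<one>\<^bsub>G\<^esub>" "\<forall>n. s n \<in> W_set G A B"
    "\<forall>n. \<forall>i<n. s n \<notin> bad (s i)"
    by (elim exE conjE)
  have carr: "s n \<in> carrier G" for n using s(2) by (simp add: W_set_iff)
  have no_clash: "\<not> clash G A B (s i) (s j)" for i j
  proof (cases i j rule: linorder_cases)
    case less
    then have "s j \<notin> bad (s i)" using s(3) by blast
    then show ?thesis using carr by (simp add: bad_def)
  next
    case equal
    then show ?thesis using s(2) by (simp add: W_set_iff)
  next
    case greater
    then have "s i \<notin> bad (s j)" using s(3) by blast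
    then show ?thesis using carr by (simp add: bad_def)
  qed
  have "inj s"
  proof (rule linorder_injI)
    fix i j :: nat assume "i < j"
    then have "s j \<notin> bad (s i)" using s(3) by blast
    then show "s i \<noteq> s j" by (auto simp: bad_def)
  qed
  then have "witness_set G A B (\<Union>n. {s n, inv\<^bsub>G\<^esub> (s n)})"
    using s(1) carr no_clash by (intro witness_set_if_no_clash)
  moreover have "countable (\<Union>n. {s n, inv\<^bsub>G\<^esub> (s n)})" by auto
  ultimately show ?thesis unfolding separable_def by blast
qed

end
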